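(* Let $\mathcal{H}_S$ and $\mathcal{H}_A$ be Hilbert spaces of the same finite dimension $d$, let $\Lambda=\{\Lambda_t\}_{t}$ be a dynamics on $\mathcal{H}_S$ (a time-parametrized family of completely positive trace-preserving linear maps on $\mathcal{L}(\mathcal{H}_S)$), and let $n\ge 1$ be an integer. If $\Lambda$ is $n$-SA-Markovian, then $\Lambda$ is $n$-S-Markovian.
   Context: Setting. $\mathcal{H}_S$ (system) and $\mathcal{H}_A$ (ancilla) are complex Hilbert spaces of the same finite dimension $d$. $\mathcal{L}(\mathcal{H})$ is the space of linear operators on $\mathcal{H}$, and $\mathcal{P}_+(\mathcal{H})$ is the set of density matrices on $\mathcal{H}$. A dynamics (dynamical map) is a family $\Lambda=\{\Lambda_t\}_{t\ge 0}$ of completely positive trace-preserving (CPTP) linear maps $\Lambda_t:\mathcal{L}(\mathcal{H}_S)\to\mathcal{L}(\mathcal{H}_S)$ indexed by time $t$. $I$ denotes the identity map on $\mathcal{L}(\mathcal{H}_A)$. Ensembles. A system ensemble of size $n$ is a collection $\mathcal{E}_S=\{p_i;\rho_i\}_{i=1}^n$ with $p_i\ge 0$, $\sum_i p_i=1$, $\rho_i\in\mathcal{P}_+(\mathcal{H}_S)$. A system-ancilla ensemble of size $n$ is a collection $\mathcal{E}_{SA}=\{p_i;\xi_i\}_{i=1}^n$ with $p_i\ge 0$, $\sum_i p_i=1$, $\xi_i\in\mathcal{P}_+(\mathcal{H}_S\otimes\mathcal{H}_A)$. $\mathcal{F}_S^n$ and $\mathcal{F}_{SA}^n$ are the sets of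 all such ensembles of size $n$; $\mathcal{F}_S=\bigcup_{n\ge1}\mathcal{F}_S^n$ and $\mathcal{F}_{SA}=\bigcup_{n\ge1}\mathcal{F}_{SA}^n$. Physicality quantifiers (PQ). A system PQ is a bounded nonnegative real function $\mathcal{I}_S:\mathcal{F}_S\to\mathbb{R}$ such that $\mathcal{I}_S\{p_i;T[\rho_i]\}\le\mathcal{I}_S\{p_i;\rho_i\}$ for every CPTP map $T$ on $\mathcal{L}(\mathcal{H}_S)$ and every ensemble. A system-ancilla PQ is a bounded nonnegative real function $\mathcal{I}_{SA}:\mathcal{F}_{SA}\to\mathbb{R}$ such that $\mathcal{I}_{SA}\{p_i;(T\otimes I)[\xi_i]\}\le\mathcal{I}_{SA}\{p_i;\xi_i\}$ for every CPTP map $T$ on $\mathcal{L}(\mathcal{H}_S)$ and every ensemble. A PQ of the form $\mathcal{I}_S^n$ (resp. $\mathcal{I}_{SA}^n$) is a system (resp. system-ancilla) PQ that vanishes on every ensemble not in $\mathcal{F}_S^n$ (resp. $\mathcal{F}_{SA}^n$). Dynamic PQ. $\Phi_t^{\mathcal{I}_S}\{p_i;\rho_i\}:=\mathcal{I}_S\{p_i;\Lambda_t[\rho_i]\}$ and $\Phi_t^{\mathcal{I}_{SA}}\{p_i;\xi_i\}:=\mathcal{I}_{SA}\{p_i;(\Lambda_t\otimes I)[\xi_i]\}$. Markovianity. $\Lambda$ is $n$-S-Markovian if for every PQ of the form $\mathcal{I}_S^n$ and every $\mathcal{E}_S\in\mathcal{F}_S^n$ the function $t\mapsto\Phi_t^{\mathcal{I}_S^n}(\mathcal{E}_S)$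 is monotonically decreasing (i.e. non-increasing). $\Lambda$ is $n$-SA-Markovian if for every PQ of the form $\mathcal{I}_{SA}^n$ and every $\mathcal{E}_{SA}\in\mathcal{F}_{SA}^n$ the function $t\mapsto\Phi_t^{\mathcal{I}_{SA}^n}(\mathcal{E}_{SA})$ is monotonically decreasing (i.e. non-increasing). *)

theory Defs
  imports "HOL-Analysis.Analysis"
begin

text \<open>A Hilbert space of finite dimension \<open>d\<close> is modelled as \<open>complex ^ 'n\<close> with \<open>CARD('n) = d\<close>,
  its operators as matrices, and the tensor product of \<open>complex ^ 's\<close> and \<open>complex ^ 'a\<close> as
  \<open>complex ^ ('s \<times> 'a)\<close>.\<close>

type_synonym 'n operator = "complex ^ 'n ^ 'n"

definition cinner :: "complex ^ 'n \<Rightarrow> complex ^ 'n \<Rightarrow> complex" where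
  "cinner v w = (\<Sum>i\<in>UNIV. cnj (v $ i) * w $ i)"

text \<open>Over the complex numbers, a nonnegative real quadratic form already forces \<open>A\<close> to be Hermitian.\<close>

definition positive_op :: "'n::finite operator \<Rightarrow> bool" where
  "positive_op A \<longleftrightarrow> (\<forall>v. cinner v (A *v v) \<in> \<real>\<^sub>\<ge>\<^sub>0)"

definition density_ops :: "'n::finite operator set" where
  "density_ops = {\<rho>. positive_op \<rho> \<and> trace \<rho> = 1}"

definition cscale :: "complex \<Rightarrow> 'n::finite operator \<Rightarrow> 'n operator" where
  "cscale c A = (\<chi> i j. c * A $ i $ j)"

lemma vector_space_cscale: "vector_space (cscale :: complex \<Rightarrow> 'n::finite operator \<Rightarrow> _)"
  by unfold_locales (auto simp: cscale_def vec_eq_iff algebra_simps)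

abbreviation linear_map :: "('n::finite operator \<Rightarrow> 'n operator) \<Rightarrow> bool" where
  "linear_map T \<equiv> Vector_Spaces.linear cscale cscale T"

text \<open>An operator on the tensor product of \<open>complex ^ 'n\<close> with a \<open>k\<close>-dimensional space is a
  \<open>k \<times> k\<close> block matrix \<open>X\<close> of operators on \<open>complex ^ 'n\<close>, and \<open>T \<otimes> id\<close> acts on it blockwise.
  As \<open>k\<close> has to be quantified over, blocks are indexed by natural numbers below \<open>k\<close>.\<close>

definition positive_block :: "nat \<Rightarrow> (nat \<Rightarrow> nat \<Rightarrow> 'n::finite operator) \<Rightarrow> bool" where
  "positive_block k X \<longleftrightarrow>
     (\<forall>v :: nat \<Rightarrow> complex ^ 'n. (\<Sum>a<k. \<Sum>b<k. cinner (v a) (X a b *v v b)) \<in> \<real>\<^sub>\<ge>\<^sub>0)"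

definition completely_positive :: "('n::finite operator \<Rightarrow> 'n operator) \<Rightarrow> bool" where
  "completely_positive T \<longleftrightarrow>
     (\<forall>k X. positive_block k X \<longrightarrow> positive_block k (\<lambda>a b. T (X a b)))"

definition trace_preserving :: "('n::finite operator \<Rightarrow> 'n operator) \<Rightarrow> bool" where
  "trace_preserving T \<longleftrightarrow> (\<forall>A. trace (T A) = trace A)"

definition cptp :: "('n::finite operator \<Rightarrow> 'n operator) \<Rightarrow> bool" where
  "cptp T \<longleftrightarrow> linear_map T \<and> completely_positive T \<and> trace_preserving T"

definition tensor_op :: "'s::finite operator \<Rightarrow> 'a::finite operator \<Rightarrow> ('s \<times> 'a) operator" where
  "tensor_op A B = (\<chi> p q. A $ fst p $ fst q * B $ snd p $ snd q)"

text \<open>The map \<open>T \<otimes> I\<close>: apply \<open>T\<close> to each system block of \<open>X\<close>. The two lemmas below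
  characterise it: it is linear and maps \<open>A \<otimes> B\<close> to \<open>T A \<otimes> B\<close>.\<close>

definition tensor_id ::
    "('s::finite operator \<Rightarrow> 's operator) \<Rightarrow> ('s \<times> 'a::finite) operator \<Rightarrow> ('s \<times> 'a) operator" where
  "tensor_id T X = (\<chi> p q. T (\<chi> i j. X $ (i, snd p) $ (j, snd q)) $ fst p $ fst q)"

lemma tensor_id_tensor_op:
  assumes "linear_map T"
  shows "tensor_id T (tensor_op A B) = tensor_op (T A) B"
proof -
  have scale: "T (cscale c M) = cscale c (T M)" for c M
    using assms by (simp add: Vector_Spaces.linear_iff)
  have "(\<chi> i j. A $ i $ j * c) = cscale c A" for c
    by (simp add: cscale_def mult.commute)
  then show ?thesis
    by (simp add: tensor_id_def tensor_op_def scale) (simp add: cscale_def mult.commute)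
qed

lemma linear_tensor_id:
  fixes T :: "'s::finite operator \<Rightarrow> 's operator"
  assumes "linear_map T"
  shows "linear_map (tensor_id T :: ('s \<times> 'a::finite) operator \<Rightarrow> _)"
proof -
  have scale: "T (cscale c M) = cscale c (T M)" and add: "T (M + N) = T M + T N" for c M N
    using assms by (simp_all add: Vector_Spaces.linear_iff)
  have "tensor_id T (X + Y) = tensor_id T X + tensor_id T Y" for X Y :: "('s \<times> 'a) operator"
  proof -
    have "(\<chi> i j. (X + Y) $ (i, a) $ (j, b))
        = (\<chi> i j. X $ (i, a) $ (j, b)) + (\<chi> i j. Y $ (i, a) $ (j, b))" for a b
      by (simp add: vec_eq_iff)
    then show ?thesis
      unfolding tensor_id_def by (simp only: add) (simp add: vec_eq_iff)
  qed
  moreover have "tensor_id T (cscale c X) = cscale c (tensor_id T X)" for c and X :: "('s \<times> 'a) operator"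
  proof -
    have "(\<chi> i j. cscale c X $ (i, a) $ (j, b)) = cscale c (\<chi> i j. X $ (i, a) $ (j, b))" for a b
      by (simp add: vec_eq_iff cscale_def)
    then show ?thesis
      unfolding tensor_id_def by (simp only: scale) (simp add: vec_eq_iff cscale_def)
  qed
  ultimately show ?thesis
    by (simp add: Vector_Spaces.linear_iff vector_space_cscale)
qed

text \<open>Ensembles are finite families indexed by \<open>1, \<dots>, n\<close>, that is, lists of length \<open>n\<close>.\<close>

type_synonym 'n ensemble = "(real \<times> 'n operator) list"

definition ensembles_of_size :: "nat \<Rightarrow> 'n::finite ensemble set" where
  "ensembles_of_size n = {E. length E = n \<and> (\<forall>(p, \<rho>)\<in>set E. 0 \<le> p \<and> \<rho> \<in> density_ops)
                              \<and> (\<Sum>(p, \<rho>)\<leftarrow>E. p) = 1}"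

definition ensembles :: "'n::finite ensemble set" where
  "ensembles = (\<Union>n\<in>{1..}. ensembles_of_size n)"

definition map_ensemble :: "('n operator \<Rightarrow> 'n operator) \<Rightarrow> 'n ensemble \<Rightarrow> 'n ensemble" where
  "map_ensemble T E = map (\<lambda>(p, \<rho>). (p, T \<rho>)) E"

text \<open>Quantifiers are total functions in HOL; only their values on \<^const>\<open>ensembles\<close> matter.\<close>

definition bounded_nonneg :: "('n::finite ensemble \<Rightarrow> real) \<Rightarrow> bool" where
  "bounded_nonneg J \<longleftrightarrow> (\<forall>E\<in>ensembles. 0 \<le> J E) \<and> (\<exists>C. \<forall>E\<in>ensembles. J E \<le> C)"

definition system_PQ :: "('s::finite ensemble \<Rightarrow> real) \<Rightarrow> bool" where
  "system_PQ J \<longleftrightarrow> bounded_nonneg J \<and>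
     (\<forall>T :: 's operator \<Rightarrow> 's operator. cptp T \<longrightarrow>
        (\<forall>E\<in>ensembles. J (map_ensemble T E) \<le> J E))"

definition system_ancilla_PQ :: "(('s::finite \<times> 'a::finite) ensemble \<Rightarrow> real) \<Rightarrow> bool" where
  "system_ancilla_PQ J \<longleftrightarrow> bounded_nonneg J \<and>
     (\<forall>T :: 's operator \<Rightarrow> 's operator. cptp T \<longrightarrow>
        (\<forall>E\<in>ensembles. J (map_ensemble (tensor_id T) E) \<le> J E))"

definition vanishes_off_size :: "nat \<Rightarrow> ('n::finite ensemble \<Rightarrow> real) \<Rightarrow> bool" where
  "vanishes_off_size n J \<longleftrightarrow> (\<forall>E\<in>ensembles - ensembles_of_size n. J E = 0)"

text \<open>Time is a real parameter; only the maps at times \<open>t \<ge> 0\<close> belong to the dynamics.\<close>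

definition dynamics :: "(real \<Rightarrow> 's::finite operator \<Rightarrow> 's operator) \<Rightarrow> bool" where
  "dynamics \<Lambda> \<longleftrightarrow> (\<forall>t\<ge>0. cptp (\<Lambda> t))"

definition dynamic_system_PQ ::
    "(real \<Rightarrow> 's::finite operator \<Rightarrow> 's operator) \<Rightarrow> ('s ensemble \<Rightarrow> real) \<Rightarrow> real \<Rightarrow> 's ensemble \<Rightarrow> real"
  where "dynamic_system_PQ \<Lambda> J t E = J (map_ensemble (\<Lambda> t) E)"

definition dynamic_system_ancilla_PQ ::
    "(real \<Rightarrow> 's::finite operator \<Rightarrow> 's operator) \<Rightarrow> (('s \<times> 'a::finite) ensemble \<Rightarrow> real)
      \<Rightarrow> real \<Rightarrow> ('s \<times> 'a) ensemble \<Rightarrow> real"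
  where "dynamic_system_ancilla_PQ \<Lambda> J t E = J (map_ensemble (tensor_id (\<Lambda> t)) E)"

definition S_Markovian :: "nat \<Rightarrow> (real \<Rightarrow> 's::finite operator \<Rightarrow> 's operator) \<Rightarrow> bool" where
  "S_Markovian n \<Lambda> \<longleftrightarrow>
     (\<forall>J. system_PQ J \<and> vanishes_off_size n J \<longrightarrow>
        (\<forall>E\<in>ensembles_of_size n. antimono_on {0..} (\<lambda>t. dynamic_system_PQ \<Lambda> J t E)))"

text \<open>The ancilla space is passed as a type argument, since it does not occur in the type of \<open>\<Lambda>\<close>.\<close>

definition SA_Markovian ::
    "'a::finite itself \<Rightarrow> nat \<Rightarrow> (real \<Rightarrow> 's::finite operator \<Rightarrow> 's operator) \<Rightarrow> bool" where
  "SA_Markovian _ n \<Lambda> \<longleftrightarrow>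
     (\<forall>J :: ('s \<times> 'a) ensemble \<Rightarrow> real. system_ancilla_PQ J \<and> vanishes_off_size n J \<longrightarrow>
        (\<forall>E\<in>ensembles_of_size n. antimono_on {0..} (\<lambda>t. dynamic_system_ancilla_PQ \<Lambda> J t E)))"

end

theory Submission
  imports Defs
begin

text \<open>Discarding the ancilla intertwines \<open>T \<otimes> I\<close> with \<open>T\<close>, so composing a system quantifier with
  the partial trace over the ancilla gives a system-ancilla quantifier. Attaching a fixed pure
  ancilla state to every member of a system ensemble is a right inverse of the partial trace, so
  each dynamic system quantifier is a dynamic system-ancilla quantifier in disguise.\<close>

definition ptrace :: "('s::finite \<times> 'a::finite) operator \<Rightarrow> 's operator" where
  "ptrace X = (\<chi> i j. \<Sum>a\<in>UNIV. X $ (i, a) $ (j, a))"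

definition basis_proj :: "'a::finite \<Rightarrow> 'a operator" where
  "basis_proj a = (\<chi> i j. if i = a \<and> j = a then 1 else 0)"

lemma sum_UNIV_prod:
  "(\<Sum>p\<in>UNIV. f p) = (\<Sum>i\<in>UNIV. \<Sum>a\<in>UNIV. f (i, a))"
  for f :: "'s::finite \<times> 'a::finite \<Rightarrow> 'b::comm_monoid_add"
  by (simp add: sum.cartesian_product)

text \<open>In both positivity proofs below the summands are supported on the slice where the
  ancilla index equals \<open>a\<close>; this collapses such a sum to one over system
  indices.\<close>

lemma sum_if_snd:
  "(\<Sum>p\<in>UNIV. if snd p = a then f p else 0) = (\<Sum>i\<in>UNIV. f (i, a))"
  for f :: "'s::finite \<times> 'a::finite \<Rightarrow> 'b::comm_monoid_add"
  by (simp add: sum_UNIV_prod)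

lemma cinner_mult_vec:
  "cinner v (A *v w) = (\<Sum>i\<in>UNIV. \<Sum>j\<in>UNIV. cnj (v $ i) * (A $ i $ j * w $ j))"
  by (simp add: cinner_def matrix_vector_mult_def sum_distrib_left)

text \<open>The partial trace adds up the diagonal system blocks, and \<open>tensor_id T\<close>
  applies \<open>T\<close> to each block separately. Hence linearity of \<open>T\<close> alone
  suffices.\<close>

lemma ptrace_tensor_id:
  assumes "linear_map T"
  shows "ptrace (tensor_id T X) = T (ptrace X)"
proof -
  define B where "B a = (\<chi> i j. X $ (i, a) $ (j, a))" for a
  have "module_hom cscale cscale T"
    using assms by (simp add: Vector_Spaces.linear_def module_hom_iff)
  have "ptrace X = (\<Sum>a\<in>UNIV. B a)"
    by (simp add: ptrace_def B_def vec_eq_iff)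
  then have "T (ptrace X) = (\<Sum>a\<in>UNIV. T (B a))"
    by (simp add: module_hom.sum [OF \<open>module_hom cscale cscale T\<close>])
  then show ?thesis
    by (simp add: ptrace_def tensor_id_def B_def vec_eq_iff)
qed

lemma ptrace_tensor_op: "ptrace (tensor_op A B) = cscale (trace B) A"
  by (simp add: ptrace_def tensor_op_def cscale_def trace_def vec_eq_iff
      sum_distrib_left mult.commute)

lemma trace_basis_proj: "trace (basis_proj a) = 1"
  by (simp add: basis_proj_def trace_def)

lemma ptrace_tensor_basis_proj: "ptrace (tensor_op A (basis_proj a)) = A"
  by (simp add: ptrace_tensor_op trace_basis_proj) (simp add: cscale_def vec_eq_iff)

lemma trace_ptrace: "trace (ptrace X) = trace X"
  by (simp add: ptrace_def trace_def sum_UNIV_prod)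

text \<open>The quadratic form of \<open>ptrace X\<close> at \<open>v\<close> is the sum over
  ancilla indices \<open>a\<close> of the form of \<open>X\<close> at v tensor e_a, with e_a the
  standard basis vector.\<close>

lemma positive_op_ptrace:
  fixes X :: "('s::finite \<times> 'a::finite) operator"
  assumes "positive_op X"
  shows "positive_op (ptrace X)"
  unfolding positive_op_def
proof
  fix v :: "complex ^ 's"
  \<comment> \<open>\<open>w a\<close> is the product vector v tensor e_a.\<close>
  define w :: "'a \<Rightarrow> complex ^ ('s \<times> 'a)"
    where "w a = (\<chi> p. if snd p = a then v $ fst p else 0)" for a
  have "cinner (w a) (X *v w a)
      = (\<Sum>i\<in>UNIV. \<Sum>j\<in>UNIV. cnj (v $ i) * (X $ (i, a) $ (j, a) * v $ j))" for a
  proof -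
    have "cinner (w a) (X *v w a) = (\<Sum>p\<in>UNIV. if snd p = a then
        (\<Sum>q\<in>UNIV. if snd q = a then cnj (v $ fst p) * (X $ p $ q * v $ fst q) else 0) else 0)"
      unfolding cinner_mult_vec w_def by (intro sum.cong refl) (auto intro: sum.cong)
    then show ?thesis
      by (simp only: sum_if_snd fst_conv)
  qed
  then have "(\<Sum>a\<in>UNIV. cinner (w a) (X *v w a))
      = (\<Sum>a\<in>UNIV. \<Sum>i\<in>UNIV. \<Sum>j\<in>UNIV. cnj (v $ i) * (X $ (i, a) $ (j, a) * v $ j))"
    by simp
  also have "\<dots> = (\<Sum>i\<in>UNIV. \<Sum>j\<in>UNIV. \<Sum>a\<in>UNIV. cnj (v $ i) * (X $ (i, a) $ (j, a) * v $ j))"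
    by (subst sum.swap, intro sum.cong refl, rule sum.swap)
  also have "\<dots> = cinner v (ptrace X *v v)"
    by (simp add: cinner_mult_vec ptrace_def sum_distrib_left sum_distrib_right)
  finally have "cinner v (ptrace X *v v) = (\<Sum>a\<in>UNIV. cinner (w a) (X *v w a))" ..
  moreover have "cinner (w a) (X *v w a) \<in> \<real>\<^sub>\<ge>\<^sub>0" for a
    using assms by (simp add: positive_op_def)
  ultimately show "cinner v (ptrace X *v v) \<in> \<real>\<^sub>\<ge>\<^sub>0"
    by (simp add: complex_nonneg_Reals_iff sum_nonneg)
qed

text \<open>The projection keeps only the slice of \<open>v\<close> with ancilla index
  \<open>a\<close>, so the quadratic form at \<open>v\<close> is that of \<open>A\<close> at this
  slice.\<close>

lemma positive_op_tensor_basis_proj: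
  fixes A :: "'s::finite operator" and a :: "'a::finite"
  assumes "positive_op A"
  shows "positive_op (tensor_op A (basis_proj a))"
  unfolding positive_op_def
proof
  fix v :: "complex ^ ('s \<times> 'a)"
  define w :: "complex ^ 's" where "w = (\<chi> i. v $ (i, a))"
  have "cinner v (tensor_op A (basis_proj a) *v v) = (\<Sum>p\<in>UNIV. if snd p = a then
      (\<Sum>q\<in>UNIV. if snd q = a then cnj (v $ p) * (A $ fst p $ fst q * v $ q) else 0) else 0)"
    unfolding cinner_mult_vec tensor_op_def basis_proj_def
    by (intro sum.cong refl) (auto intro: sum.cong)
  also have "\<dots> = cinner w (A *v w)"
    by (simp only: sum_if_snd fst_conv) (simp add: cinner_mult_vec w_def)
  finally have "cinner v (tensor_op A (basis_proj a) *v v) = cinner w (A *v w)" .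
  then show "cinner v (tensor_op A (basis_proj a) *v v) \<in> \<real>\<^sub>\<ge>\<^sub>0"
    using assms by (simp add: positive_op_def)
qed

lemma ptrace_density_ops: "X \<in> density_ops \<Longrightarrow> ptrace X \<in> density_ops"
  by (simp add: density_ops_def positive_op_ptrace trace_ptrace)

lemma tensor_basis_proj_density_ops:
  "A \<in> density_ops \<Longrightarrow> tensor_op A (basis_proj a) \<in> density_ops"
  \<comment> \<open>The trace condition comes from the partial trace, which preserves the trace and
    returns \<open>A\<close> here.\<close>
  using trace_ptrace [of "tensor_op A (basis_proj a)"]
  by (simp add: density_ops_def positive_op_tensor_basis_proj ptrace_tensor_basis_proj)

text \<open>Unlike \<^const>\<open>map_ensemble\<close>, this allows the underlying space to change.\<close>

abbreviation map_states ::
    "('m operator \<Rightarrow> 'n operator) \<Rightarrow> 'm ensemble \<Rightarrow> 'n ensemble" where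
  "map_states f \<equiv> map (\<lambda>(p, \<rho>). (p, f \<rho>))"

lemma map_states_ensembles_of_size:
  assumes "\<And>\<rho>. \<rho> \<in> density_ops \<Longrightarrow> f \<rho> \<in> density_ops" and "E \<in> ensembles_of_size n"
  shows "map_states f E \<in> ensembles_of_size n"
  using assms by (fastforce simp: ensembles_of_size_def comp_def case_prod_unfold)

lemma map_states_ensembles:
  assumes "\<And>\<rho>. \<rho> \<in> density_ops \<Longrightarrow> f \<rho> \<in> density_ops" and "E \<in> ensembles"
  shows "map_states f E \<in> ensembles"
  using assms map_states_ensembles_of_size [of f] unfolding ensembles_def by blast

lemma map_states_ptrace_ensembles: "E \<in> ensembles \<Longrightarrow> map_states ptrace E \<in> ensembles"
  by (rule map_states_ensembles) (rule ptrace_density_ops)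

lemma map_states_ptrace_tensor_id:
  assumes "linear_map T"
  shows "map_states ptrace (map_ensemble (tensor_id T) E) = map_ensemble T (map_states ptrace E)"
  by (simp add: map_ensemble_def ptrace_tensor_id [OF assms] case_prod_unfold)

text \<open>Bounds carry over because reduced ensembles are again ensembles. Monotonicity under
  \<open>tensor_id T\<close> is monotonicity of \<open>J\<close> under \<open>T\<close> at the
  reduced ensemble.\<close>

lemma system_ancilla_PQ_ptrace:
  assumes "system_PQ J"
  shows "system_ancilla_PQ (\<lambda>E :: ('s::finite \<times> 'a::finite) ensemble. J (map_states ptrace E))"
proof -
  have "bounded_nonneg J"
    using assms by (simp add: system_PQ_def)
  then have "bounded_nonneg (\<lambda>E :: ('s \<times> 'a) ensemble. J (map_states ptrace E))"
    unfolding bounded_nonneg_def using map_states_ptrace_ensembles by blast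
  moreover have "J (map_states ptrace (map_ensemble (tensor_id T) E)) \<le> J (map_states ptrace E)"
    if "cptp T" and "E \<in> ensembles" for T and E :: "('s \<times> 'a) ensemble"
    using assms that
    by (simp add: system_PQ_def cptp_def map_states_ptrace_tensor_id map_states_ptrace_ensembles)
  ultimately show ?thesis
    by (simp add: system_ancilla_PQ_def)
qed

lemma vanishes_off_size_ptrace:
  assumes "vanishes_off_size n J"
  shows "vanishes_off_size n (\<lambda>E :: ('s::finite \<times> 'a::finite) ensemble. J (map_states ptrace E))"
  unfolding vanishes_off_size_def
proof
  fix E :: "('s \<times> 'a) ensemble"
  assume E: "E \<in> ensembles - ensembles_of_size n"
  \<comment> \<open>An ensemble has valid weights and states, so only its length can keep it from
    having size \<open>n\<close>; reducing the states leaves the length unchanged.\<close>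
  then have "length E \<noteq> n"
    by (auto simp: ensembles_def ensembles_of_size_def)
  then have "map_states ptrace E \<notin> ensembles_of_size n"
    by (simp add: ensembles_of_size_def)
  with E show "J (map_states ptrace E) = 0"
    using assms map_states_ptrace_ensembles
    by (auto simp: vanishes_off_size_def)
qed

theorem theorem1:
  fixes \<Lambda> :: "real \<Rightarrow> 's::finite operator \<Rightarrow> 's operator" and n :: nat
  assumes "CARD('a::finite) = CARD('s)"
    and "dynamics \<Lambda>"
    and "n \<ge> 1"
    and "SA_Markovian TYPE('a) n \<Lambda>"
  shows "S_Markovian n \<Lambda>"
  unfolding S_Markovian_def
proof (intro allI impI ballI)
  fix J :: "'s ensemble \<Rightarrow> real" and E :: "'s ensemble"
  assume J: "system_PQ J \<and> vanishes_off_size n J" and E: "E \<in> ensembles_of_size n"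
  define J' where "J' F = J (map_states ptrace F)" for F :: "('s \<times> 'a) ensemble"
  \<comment> \<open>Any ancilla basis index would serve, so \<open>undefined\<close> picks an
    unspecified one.\<close>
  define E' where "E' = map_states (\<lambda>\<rho>. tensor_op \<rho> (basis_proj (undefined :: 'a))) E"
  have "system_ancilla_PQ J'" and "vanishes_off_size n J'"
    using J system_ancilla_PQ_ptrace vanishes_off_size_ptrace unfolding J'_def by blast+
  moreover have "E' \<in> ensembles_of_size n"
    unfolding E'_def
    using map_states_ensembles_of_size [OF tensor_basis_proj_density_ops E] .
  ultimately have "antimono_on {0..} (\<lambda>t. dynamic_system_ancilla_PQ \<Lambda> J' t E')"
    using assms(4) by (simp add: SA_Markovian_def)
  moreover have "dynamic_system_ancilla_PQ \<Lambda> J' t E' = dynamic_system_PQ \<Lambda> J t E" if "t \<ge> 0" for t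
  proof -
    have "linear_map (\<Lambda> t)"
      using assms(2) that by (simp add: dynamics_def cptp_def)
    moreover have "map_states ptrace E' = E"
      by (simp add: E'_def ptrace_tensor_basis_proj comp_def case_prod_unfold)
    ultimately show ?thesis
      by (simp add: dynamic_system_ancilla_PQ_def dynamic_system_PQ_def J'_def
          map_states_ptrace_tensor_id)
  qed
  \<comment> \<open>The two dynamic quantifiers are known to agree only at times t \<ge> 0, which is
    exactly the range on which antitonicity is claimed.\<close>
  ultimately show "antimono_on {0..} (\<lambda>t. dynamic_system_PQ \<Lambda> J t E)"
    by (simp add: monotone_on_def)
qed

end
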